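(* Let $Z$ be a countable totally ordered set, let $\lozenge$ be a $\mathbb{Q}$-bilinear, commutative, associative product on the vector space $\mathbb{Q}Z$ with basis $Z$, and let $\star$ be the associated generalised quasi-shuffle product on $\mathbb{Q}\langle Z\rangle$. Then $(\mathbb{Q}\langle Z\rangle,\star)$ is the free (commutative) polynomial algebra over $\mathbb{Q}$ on the set of Lyndon words in $Z$.
   Context: $\mathbb{Q}\langle Z\rangle$ is the vector space of non-commutative polynomials in the letters $Z$, with basis the words (monomials) in $Z$, the empty word being $1$. For $c\in\mathbb{Q}Z$, let $L_c:\mathbb{Q}\langle Z\rangle\to\mathbb{Q}\langle Z\rangle$ be the linear map with $L_c(1)=0$ and $L_c(xw)=(c\lozenge x)w$ for $x\in Z$ and $w$ a word. The generalised quasi-shuffle product $\star$ is the bilinear product defined recursively by $w\star 1=1\star w=w$ and $$au\star bv=a(u\star bv)+b(au\star v)-L_{a\lozenge b}(u\star v)$$ for letters $a,b\in Z$ and words $u,v,w$. (It is commutative and associative.) A Lyndon word is a non-empty word that is strictly smaller, in the lexicographic order induced by the order on $Z$, than each of its proper non-empty suffixes. *)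

theory Defs
  imports Complex_Main "HOL-Library.Poly_Mapping" "HOL-Library.List_Lexorder"
    "HOL-Library.Countable_Set"
begin

text \<open>
  The rational vector space with basis \<open>S\<close> is the space of finitely supported functions
  on the ambient type whose support lies in \<open>S\<close>. The alphabet is a set rather than a whole
  type, so that it may be empty.
\<close>

definition free_space :: "'a set \<Rightarrow> ('a \<Rightarrow>\<^sub>0 rat) set" where
  "free_space S = {p. Poly_Mapping.keys p \<subseteq> S}"

definition basis :: "'a \<Rightarrow> ('a \<Rightarrow>\<^sub>0 rat)" where
  "basis a = Poly_Mapping.single a 1"

definition scale :: "rat \<Rightarrow> ('a \<Rightarrow>\<^sub>0 rat) \<Rightarrow> ('a \<Rightarrow>\<^sub>0 rat)" where
  "scale c p = Poly_Mapping.map ((*) c) p"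

definition lin_ext :: "('a \<Rightarrow> ('b \<Rightarrow>\<^sub>0 rat)) \<Rightarrow> ('a \<Rightarrow>\<^sub>0 rat) \<Rightarrow> ('b \<Rightarrow>\<^sub>0 rat)" where
  "lin_ext f p = (\<Sum>a\<in>Poly_Mapping.keys p. scale (Poly_Mapping.lookup p a) (f a))"

definition bilinear_on ::
  "('a \<Rightarrow>\<^sub>0 rat) set \<Rightarrow> (('a \<Rightarrow>\<^sub>0 rat) \<Rightarrow> ('a \<Rightarrow>\<^sub>0 rat) \<Rightarrow> ('a \<Rightarrow>\<^sub>0 rat)) \<Rightarrow> bool" where
  "bilinear_on V f \<longleftrightarrow>
     (\<forall>p\<in>V. \<forall>q\<in>V. f p q \<in> V) \<and>
     (\<forall>p\<in>V. \<forall>q\<in>V. \<forall>r\<in>V. f (p + q) r = f p r + f q r \<and> f r (p + q) = f r p + f r q) \<and>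
     (\<forall>c. \<forall>p\<in>V. \<forall>q\<in>V. f (scale c p) q = scale c (f p q) \<and> f p (scale c q) = scale c (f p q))"

text \<open>
  \<open>vec_word c w\<close> is the concatenation \<open>c w\<close> of a linear combination \<open>c\<close> of letters
  with a word \<open>w\<close>, and \<open>prepend a p\<close> is \<open>a p\<close> for a letter \<open>a\<close> and a polynomial \<open>p\<close>.
\<close>

definition vec_word :: "('z \<Rightarrow>\<^sub>0 rat) \<Rightarrow> 'z list \<Rightarrow> ('z list \<Rightarrow>\<^sub>0 rat)" where
  "vec_word c w = lin_ext (\<lambda>y. basis (y # w)) c"

definition prepend :: "'z \<Rightarrow> ('z list \<Rightarrow>\<^sub>0 rat) \<Rightarrow> ('z list \<Rightarrow>\<^sub>0 rat)" where
  "prepend a = lin_ext (\<lambda>w. basis (a # w))"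

definition L_map ::
  "(('z \<Rightarrow>\<^sub>0 rat) \<Rightarrow> ('z \<Rightarrow>\<^sub>0 rat) \<Rightarrow> ('z \<Rightarrow>\<^sub>0 rat)) \<Rightarrow> ('z \<Rightarrow>\<^sub>0 rat) \<Rightarrow>
   ('z list \<Rightarrow>\<^sub>0 rat) \<Rightarrow> ('z list \<Rightarrow>\<^sub>0 rat)" where
  "L_map dia c =
     lin_ext (\<lambda>w. case w of [] \<Rightarrow> 0 | x # v \<Rightarrow> vec_word (dia c (basis x)) v)"

fun star_words ::
  "(('z \<Rightarrow>\<^sub>0 rat) \<Rightarrow> ('z \<Rightarrow>\<^sub>0 rat) \<Rightarrow> ('z \<Rightarrow>\<^sub>0 rat)) \<Rightarrow> 'z list \<Rightarrow> 'z list \<Rightarrow> ('z list \<Rightarrow>\<^sub>0 rat)"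
where
  "star_words dia [] w = basis w"
| "star_words dia w [] = basis w"
| "star_words dia (a # u) (b # v) =
     prepend a (star_words dia u (b # v)) + prepend b (star_words dia (a # u) v)
     - L_map dia (dia (basis a) (basis b)) (star_words dia u v)"

definition star ::
  "(('z \<Rightarrow>\<^sub>0 rat) \<Rightarrow> ('z \<Rightarrow>\<^sub>0 rat) \<Rightarrow> ('z \<Rightarrow>\<^sub>0 rat)) \<Rightarrow>
   ('z list \<Rightarrow>\<^sub>0 rat) \<Rightarrow> ('z list \<Rightarrow>\<^sub>0 rat) \<Rightarrow> ('z list \<Rightarrow>\<^sub>0 rat)" where
  "star dia p q = lin_ext (\<lambda>u. lin_ext (\<lambda>v. star_words dia u v) q) p"

text \<open>The order on words is the one of \<^theory>\<open>HOL-Library.List_Lexorder\<close>: a proper prefix is smaller.\<close>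

definition lyndon :: "'z::linorder list \<Rightarrow> bool" where
  "lyndon w \<longleftrightarrow> w \<noteq> [] \<and> (\<forall>u v. w = u @ v \<and> u \<noteq> [] \<and> v \<noteq> [] \<longrightarrow> w < v)"

text \<open>
  The type \<open>('i \<Rightarrow>\<^sub>0 nat) \<Rightarrow>\<^sub>0 rat\<close> with its ring structure from
  \<^theory>\<open>HOL-Library.Poly_Mapping\<close> is the ring of commutative polynomials in the variables \<open>'i\<close>:
  an exponent vector \<open>'i \<Rightarrow>\<^sub>0 nat\<close> is a monomial, and the product is convolution.
\<close>

definition poly_ring :: "'i set \<Rightarrow> (('i \<Rightarrow>\<^sub>0 nat) \<Rightarrow>\<^sub>0 rat) set" where
  "poly_ring I = {P. \<forall>m\<in>Poly_Mapping.keys P. Poly_Mapping.keys m \<subseteq> I}"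

definition poly_var :: "'i \<Rightarrow> (('i \<Rightarrow>\<^sub>0 nat) \<Rightarrow>\<^sub>0 rat)" where
  "poly_var i = Poly_Mapping.single (Poly_Mapping.single i 1) 1"

text \<open>
  The rational algebra with underlying space \<open>A\<close>, product \<open>mul\<close> and unit \<open>e\<close> is the free
  polynomial algebra on the family \<open>g\<close> indexed by \<open>I\<close>: sending the variable of index \<open>i\<close>
  to \<open>g i\<close> extends to an algebra isomorphism from the polynomial ring onto \<open>A\<close>.
\<close>

definition free_polynomial_algebra ::
  "('b \<Rightarrow>\<^sub>0 rat) set \<Rightarrow> (('b \<Rightarrow>\<^sub>0 rat) \<Rightarrow> ('b \<Rightarrow>\<^sub>0 rat) \<Rightarrow> ('b \<Rightarrow>\<^sub>0 rat)) \<Rightarrow> ('b \<Rightarrow>\<^sub>0 rat) \<Rightarrow>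
   'i set \<Rightarrow> ('i \<Rightarrow> ('b \<Rightarrow>\<^sub>0 rat)) \<Rightarrow> bool" where
  "free_polynomial_algebra A mul e I g \<longleftrightarrow>
     (\<exists>\<Phi>. bij_betw \<Phi> (poly_ring I) A \<and>
          (\<forall>P\<in>poly_ring I. \<forall>Q\<in>poly_ring I. \<Phi> (P + Q) = \<Phi> P + \<Phi> Q) \<and>
          (\<forall>c. \<forall>P\<in>poly_ring I. \<Phi> (scale c P) = scale c (\<Phi> P)) \<and>
          (\<forall>P\<in>poly_ring I. \<forall>Q\<in>poly_ring I. \<Phi> (P * Q) = mul (\<Phi> P) (\<Phi> Q)) \<and>
          \<Phi> 1 = e \<and>
          (\<forall>i\<in>I. \<Phi> (poly_var i) = g i))"

end

theory Submission
  imports Defs "HOL-Library.Multiset" "HOL-Library.Product_Lexorder" "HOL-Library.Sublist"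
begin

text \<open>
  The proof compares the product with the concatenation of words. Every word is a concatenation
  of Lyndon words in weakly decreasing order, in exactly one way
  (\<open>bij_lyndon_factorisation\<close>), so monomials in the Lyndon words correspond to words. The claim is that
  the substitution which sends a monomial to the product of its Lyndon words is
  triangular with respect to this correspondence, with nonzero diagonal.

  The recursion for the product \<open>u \<star> v\<close> consists of a shuffle part, which keeps all letters, and
  of terms in which letters are merged, which are shorter. So the words of full length
  in a product of Lyndon words are their shuffles, with positive coefficients (\<open>star_words_top\<close>).
  Among the shuffles of Lyndon words the lexicographically largest is their concatenation in
  decreasing order (\<open>shuffles_le_concat_desc\<close>). Hence a product of Lyndon words is a positive
  multiple of this concatenation, plus smaller rearrangements of it, plus shorter words. The
  order that is used here is well-founded, because a word has finitely many rearrangements, and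
  a triangular map for a well-founded order is bijective (\<open>triangular_bij_betw\<close>).

  For the substitution to be multiplicative, the product has to be commutative and
  associative. Commutativity is visible in the recursion. For associativity, expand
  a product of three words by the recursion: with the help of an identity for \<open>L d q \<star> c w\<close>
  (\<open>L_star\<close>) the result is symmetric in the three factors (\<open>star_triple\<close>), so induction on the
  total length shows that the product of three words is invariant under rotation.
\<close>

section \<open>Linear maps between spaces of finitely supported functions\<close>

abbreviation lookup :: "('a \<Rightarrow>\<^sub>0 'b::zero) \<Rightarrow> 'a \<Rightarrow> 'b" where
  "lookup \<equiv> Poly_Mapping.lookup"

abbreviation keys :: "('a \<Rightarrow>\<^sub>0 'b::zero) \<Rightarrow> 'a set" where
  "keys \<equiv> Poly_Mapping.keys"

lemma lookup_scale [simp]: "lookup (scale c p) a = c * lookup p a"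
  unfolding scale_def by (simp add: Poly_Mapping.map.rep_eq when_def)

lemma lookup_basis: "lookup (basis a) b = (if a = b then 1 else 0)"
  by (simp add: basis_def lookup_single when_def)

lemma keys_basis [simp]: "keys (basis a) = {a}"
  by (simp add: basis_def)

lemma module_scale: "module scale"
  by standard (auto intro!: poly_mapping_eqI simp: lookup_add algebra_simps)

abbreviation lin :: "(('a \<Rightarrow>\<^sub>0 rat) \<Rightarrow> ('b \<Rightarrow>\<^sub>0 rat)) \<Rightarrow> bool" where
  "lin \<equiv> module_hom scale scale"

lemma linI:
  "(\<And>p q. f (p + q) = f p + f q) \<Longrightarrow> (\<And>c p. f (scale c p) = scale c (f p)) \<Longrightarrow> lin f"
  by (intro module_hom.intro module_hom_axioms.intro module_scale)

lemma scale_simps: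
  "scale c (p + q) = scale c p + scale c q" "scale c (p - q) = scale c p - scale c q"
  "scale (c + d) p = scale c p + scale d p" "scale 1 p = p" "scale 0 p = 0" "scale c 0 = 0"
  "scale c (scale d p) = scale (c * d) p"
  by (auto intro!: poly_mapping_eqI simp: lookup_add lookup_minus algebra_simps)

lemma lin_const_zero: "lin (\<lambda>p. 0)"
  by (rule linI) (simp_all add: scale_simps)

lemma lin_id: "lin (\<lambda>p. p)"
  by (rule linI) simp_all

lemma lin_plus: "lin f \<Longrightarrow> lin g \<Longrightarrow> lin (\<lambda>p. f p + g p)"
  by (rule linI) (simp_all add: module_hom.add module_hom.scale scale_simps)

lemma lin_minus: "lin f \<Longrightarrow> lin g \<Longrightarrow> lin (\<lambda>p. f p - g p)"
  by (rule linI) (simp_all add: module_hom.add module_hom.scale scale_simps)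

lemma lin_compose: "lin f \<Longrightarrow> lin g \<Longrightarrow> lin (\<lambda>p. f (g p))"
  by (rule linI) (simp_all add: module_hom.add module_hom.scale)

lemma lookup_lin_ext:
  assumes "finite S" "keys p \<subseteq> S"
  shows "lookup (lin_ext f p) b = (\<Sum>a\<in>S. lookup p a * lookup (f a) b)"
proof -
  have "lookup (lin_ext f p) b = (\<Sum>a\<in>keys p. lookup p a * lookup (f a) b)"
    by (simp add: lin_ext_def lookup_sum)
  also have "\<dots> = (\<Sum>a\<in>S. lookup p a * lookup (f a) b)"
    using assms by (intro sum.mono_neutral_left) (auto simp: in_keys_iff)
  finally show ?thesis .
qed

lemma lin_lin_ext: "lin (lin_ext f)"
proof (rule linI)
  fix p q :: "'a \<Rightarrow>\<^sub>0 rat" and c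
  let ?S = "keys p \<union> keys q"
  have "keys (p + q) \<subseteq> ?S" by (rule keys_add)
  then show "lin_ext f (p + q) = lin_ext f p + lin_ext f q"
    by (intro poly_mapping_eqI)
      (simp add: lookup_add lookup_lin_ext[of ?S] sum.distrib[symmetric] algebra_simps)
  have "keys (scale c p) \<subseteq> keys p" by (auto simp: in_keys_iff)
  then show "lin_ext f (scale c p) = scale c (lin_ext f p)"
    by (intro poly_mapping_eqI)
      (simp add: lookup_lin_ext[of "keys p"] sum_distrib_left mult.assoc)
qed

text \<open>
  Most maps of this development are nested linear extensions; this rule provides linearity
  in the parameters that occur below the extension.
\<close>

lemma lin_lin_ext_param:
  assumes "\<And>a. lin (\<lambda>c. f c a)"
  shows "lin (\<lambda>c. lin_ext (f c) p)"
  by (rule linI; rule poly_mapping_eqI)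
    (simp_all add: lookup_lin_ext[of "keys p"] module_hom.add[OF assms] module_hom.scale[OF assms]
      lookup_add sum.distrib[symmetric] sum_distrib_left algebra_simps)

lemma lin_ext_basis [simp]: "lin_ext f (basis a) = f a"
  by (rule poly_mapping_eqI) (simp add: lookup_lin_ext[of "{a}"] lookup_basis)

lemma basis_expansion: "(\<Sum>a\<in>keys p. scale (lookup p a) (basis a)) = p"
  by (rule poly_mapping_eqI) (simp add: lookup_sum lookup_basis in_keys_iff if_distrib cong: if_cong)

lemma lin_eqI:
  assumes "lin f" "lin g" "\<And>a. a \<in> keys p \<Longrightarrow> f (basis a) = g (basis a)"
  shows "f p = g p"
proof -
  have "f (\<Sum>a\<in>keys p. scale (lookup p a) (basis a)) = g (\<Sum>a\<in>keys p. scale (lookup p a) (basis a))"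
    using assms by (simp add: module_hom.sum module_hom.scale)
  then show ?thesis by (simp add: basis_expansion)
qed

lemma bilin_eqI:
  assumes "\<And>q. lin (\<lambda>p. f p q)" "\<And>q. lin (\<lambda>p. g p q)" "\<And>p. lin (f p)" "\<And>p. lin (g p)"
    and "\<And>a b. f (basis a) (basis b) = g (basis a) (basis b)"
  shows "f p q = g p q"
proof (rule lin_eqI[of "\<lambda>p. f p q" "\<lambda>p. g p q"])
  show "f (basis a) q = g (basis a) q" for a
    by (rule lin_eqI[of "f (basis a)" "g (basis a)"]) (rule assms)+
qed (rule assms)+

lemma lin_prepend [simp]: "lin (prepend a)"
  unfolding prepend_def by (rule lin_lin_ext)

lemma lin_L_map [simp]: "lin (L_map dia c)"
  unfolding L_map_def by (rule lin_lin_ext)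

lemma lin_star_right [simp]: "lin (star dia p)"
  unfolding star_def by (intro lin_lin_ext_param lin_lin_ext)

lemma lin_star_left [simp]: "lin (\<lambda>p. star dia p q)"
  unfolding star_def by (rule lin_lin_ext)

lemma star_basis [simp]: "star dia (basis u) (basis v) = star_words dia u v"
  by (simp add: star_def)

lemma star_words_Nil_right [simp]: "star_words dia w [] = basis w"
  by (cases w) simp_all

lemma star_Nil_left [simp]: "star dia (basis []) p = p"
  by (rule lin_eqI[OF lin_star_right lin_id]) simp

lemma star_Nil_right [simp]: "star dia p (basis []) = p"
  by (rule lin_eqI[OF lin_star_left lin_id]) simp

section \<open>Commutativity and associativity of the quasi-shuffle product\<close>

text \<open>
  Merging two letters produces a linear combination of letters, so the recursion for the
  product leaves the letters of the alphabet. Prefixing by arbitrary vectors of letters keeps all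
  identities below inside one calculus.
\<close>

definition vec_prepend :: "('z \<Rightarrow>\<^sub>0 rat) \<Rightarrow> ('z list \<Rightarrow>\<^sub>0 rat) \<Rightarrow> ('z list \<Rightarrow>\<^sub>0 rat)" where
  "vec_prepend c = lin_ext (vec_word c)"

lemma lin_vec_prepend [simp]: "lin (vec_prepend c)"
  unfolding vec_prepend_def by (rule lin_lin_ext)

lemma lin_vec_prepend_left [simp]: "lin (\<lambda>c. vec_prepend c p)"
  unfolding vec_prepend_def vec_word_def by (intro lin_lin_ext_param lin_lin_ext)

lemma vec_word_eq [simp]: "vec_word c w = vec_prepend c (basis w)"
  by (simp add: vec_prepend_def)

lemma vec_prepend_letter [simp]: "vec_prepend (basis a) p = prepend a p"
  unfolding vec_prepend_def prepend_def by (rule lin_eqI[OF lin_lin_ext lin_lin_ext]) (simp add: vec_word_def del: vec_word_eq)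

lemma prepend_basis [simp]: "prepend a (basis w) = basis (a # w)"
  by (simp add: prepend_def)

lemma L_map_basis_Nil [simp]: "L_map dia c (basis []) = 0"
  by (simp add: L_map_def)

lemma L_map_basis_Cons [simp]:
  "L_map dia c (basis (x # v)) = vec_prepend (dia c (basis x)) (basis v)"
  by (simp add: L_map_def)

text \<open>
  The letter product is total here, so that the words form a commutative monoid without side
  conditions on carriers. A product that is only given on the span of an alphabet is
  brought into this form further below, by composing it with a projection.
\<close>

locale letter_algebra =
  fixes dia :: "('z \<Rightarrow>\<^sub>0 rat) \<Rightarrow> ('z \<Rightarrow>\<^sub>0 rat) \<Rightarrow> ('z \<Rightarrow>\<^sub>0 rat)"
  assumes lin_dia [simp]: "lin (dia c)"
    and dia_comm: "dia c d = dia d c"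
    and dia_assoc: "dia (dia c d) e = dia c (dia d e)"
begin

abbreviation qshuffle (infixl \<open>\<star>\<close> 70) where "p \<star> q \<equiv> star dia p q"
abbreviation L where "L \<equiv> L_map dia"

lemma lin_dia_left [simp]: "lin (\<lambda>d. dia d c)"
  using lin_dia[of c] by (simp add: dia_comm[of _ c])

lemma L_prepend: "L c (prepend x p) = vec_prepend (dia c (basis x)) p"
  by (rule lin_eqI[of "\<lambda>p. L c (prepend x p)"])
    (simp_all add: lin_compose)

lemma L_vec_prepend: "L c (vec_prepend d p) = vec_prepend (dia c d) p"
  by (rule lin_eqI[of "\<lambda>d. L c (vec_prepend d p)"])
    (auto intro: lin_compose[of "L c"] lin_compose[of "\<lambda>c. vec_prepend c p"] simp: L_prepend)

lemma lin_L_left [simp]: "lin (\<lambda>c. L c p)"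
proof -
  have "lin (\<lambda>c. case w of [] \<Rightarrow> 0 | x # v \<Rightarrow> vec_word (dia c (basis x)) v)" for w
    by (cases w)
      (simp_all add: lin_const_zero lin_compose[OF lin_vec_prepend_left lin_dia_left])
  then show ?thesis unfolding L_map_def by (rule lin_lin_ext_param)
qed

lemma star_words_commute: "star_words dia u v = star_words dia v u"
proof -
  have "d = dia \<Longrightarrow> star_words d u v = star_words d v u" for d
  proof (induction d u v rule: star_words.induct)
    case (3 d a u b v)
    then show ?case by (simp add: dia_comm[of "basis a"] add.commute)
  qed simp_all
  then show ?thesis by simp
qed

lemma star_commute: "p \<star> q = q \<star> p"
proof (rule bilin_eqI[of "star dia" "\<lambda>p q. q \<star> p"])
  show "lin (\<lambda>p. p \<star> q)" for q by (rule lin_star_left)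
  show "lin (\<lambda>p. q \<star> p)" for q by (rule lin_star_right)
  show "lin (star dia p)" for p by (rule lin_star_right)
  show "lin (\<lambda>q. q \<star> p)" for p by (rule lin_star_left)
  show "basis u \<star> basis v = basis v \<star> basis u" for u v
    using star_words_commute[of u v] by simp
qed

text \<open>
  Each composition rule fixes its outer map. The rule for two unknown maps would
  match every goal, including its own premises.
\<close>

lemmas lin_ops = lin_plus lin_minus lin_id lin_const_zero
  lin_compose[OF lin_prepend] lin_compose[OF lin_vec_prepend] lin_compose[OF lin_vec_prepend_left]
  lin_compose[OF lin_L_map] lin_compose[OF lin_L_left]
  lin_compose[OF lin_star_right] lin_compose[OF lin_star_left]
  lin_compose[OF lin_dia] lin_compose[OF lin_dia_left]

text \<open>
  Both sides are linear in \<open>c\<close> and in \<open>p\<close>, and on basis vectors the identity is the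
  defining recursion.
\<close>

lemma star_vec_prepend:
  "vec_prepend c p \<star> basis (b # v) =
     vec_prepend c (p \<star> basis (b # v)) + prepend b (vec_prepend c p \<star> basis v)
     - L (dia c (basis b)) (p \<star> basis v)"
  by (rule bilin_eqI[of "\<lambda>c p. vec_prepend c p \<star> basis (b # v)"]) (auto intro!: lin_ops)

lemma L_L: "L c (L d p) = L (dia c d) p"
proof (rule lin_eqI[of "\<lambda>p. L c (L d p)"])
  fix w
  show "L c (L d (basis w)) = L (dia c d) (basis w)"
  proof (cases w)
    case Nil
    then show ?thesis by (simp add: module_hom.zero[OF lin_L_map])
  next
    case (Cons x v)
    then show ?thesis
      by (simp add: L_vec_prepend dia_assoc)
  qed
qed (auto intro!: lin_ops)

text \<open>
  This is the identity on which associativity rests: it moves \<open>L d\<close> out of a product.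
  On \<open>q = x v\<close> the vector \<open>L d q\<close> is \<open>v\<close> prefixed by \<open>dia d x\<close>, and the recursion for the
  left-hand side differs from \<open>L d\<close> applied to the recursion for \<open>q \<star> c w\<close> only in what
  becomes of the terms that start with \<open>c\<close>; the double merges agree since \<open>dia\<close> is associative.
  On the empty word \<open>L d\<close> vanishes, and the first and last terms on the right cancel.
\<close>

lemma L_star:
  "L d q \<star> basis (c # w) =
     L d (q \<star> basis (c # w)) + prepend c (L d q \<star> basis w) - vec_prepend (dia d (basis c)) (q \<star> basis w)"
proof (rule lin_eqI[of "\<lambda>q. L d q \<star> basis (c # w)"])
  fix u
  show "L d (basis u) \<star> basis (c # w) =
     L d (basis u \<star> basis (c # w)) + prepend c (L d (basis u) \<star> basis w)
      - vec_prepend (dia d (basis c)) (basis u \<star> basis w)"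
  proof (cases u)
    case Nil
    have "0 \<star> p = 0" for p
      by (rule module_hom.zero[OF lin_star_left])
    with Nil show ?thesis
      by (simp add: module_hom.zero[OF lin_prepend])
  next
    case (Cons x v)
    have "L d (basis u) \<star> basis (c # w) = vec_prepend (dia d (basis x)) (basis v) \<star> basis (c # w)"
      using Cons by simp
    also have "\<dots> = vec_prepend (dia d (basis x)) (basis v \<star> basis (c # w))
        + prepend c (L d (basis u) \<star> basis w) - L (dia (dia d (basis x)) (basis c)) (basis v \<star> basis w)"
      unfolding star_vec_prepend using Cons by simp
    also have "\<dots> = L d (basis u \<star> basis (c # w)) + prepend c (L d (basis u) \<star> basis w)
        - vec_prepend (dia d (basis c)) (basis u \<star> basis w)"
      using Cons by (simp add: L_prepend L_L dia_assoc module_hom.add[OF lin_L_map] module_hom.diff[OF lin_L_map])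
    finally show ?thesis .
  qed
qed (auto intro!: lin_ops)

text \<open>
  The right-hand side treats the three factors alike: either one first letter is taken,
  or two of them are merged, or all three. The terms in which \<open>c\<close> is prefixed
  to products of \<open>w'\<close> with parts of \<open>U \<star> V\<close> recombine to the third summand.
\<close>

lemma star_triple:
  fixes a b c :: 'z and u v w :: "'z list"
  defines "U \<equiv> basis (a # u)" and "V \<equiv> basis (b # v)" and "W \<equiv> basis (c # w)"
    and "u' \<equiv> basis u" and "v' \<equiv> basis v" and "w' \<equiv> basis w"
    and "a' \<equiv> basis a" and "b' \<equiv> basis b" and "c' \<equiv> basis c"
  shows "U \<star> V \<star> W = prepend a (u' \<star> V \<star> W) + prepend b (U \<star> v' \<star> W) + prepend c (U \<star> V \<star> w')
    - L (dia a' b') (u' \<star> v' \<star> W) - L (dia a' c') (u' \<star> V \<star> w') - L (dia b' c') (U \<star> v' \<star> w')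
    + vec_prepend (dia (dia a' b') c') (u' \<star> v' \<star> w')"
proof -
  have pre: "prepend x p \<star> W = prepend x (p \<star> W) + prepend c (prepend x p \<star> w') - L (dia (basis x) c') (p \<star> w')"
    for x p using star_vec_prepend[of "basis x" p c w] by (simp add: W_def w'_def c'_def)
  have UV: "U \<star> V = prepend a (u' \<star> V) + prepend b (U \<star> v') - L (dia a' b') (u' \<star> v')"
    by (simp add: U_def V_def u'_def v'_def a'_def b'_def)
  have "U \<star> V \<star> W = prepend a (u' \<star> V) \<star> W + prepend b (U \<star> v') \<star> W - L (dia a' b') (u' \<star> v') \<star> W"
    unfolding UV by (simp add: module_hom.add[OF lin_star_left] module_hom.diff[OF lin_star_left])
  moreover have "U \<star> V \<star> w' = prepend a (u' \<star> V) \<star> w' + prepend b (U \<star> v') \<star> w' - L (dia a' b') (u' \<star> v') \<star> w'"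
    unfolding UV by (simp add: module_hom.add[OF lin_star_left] module_hom.diff[OF lin_star_left])
  moreover have "L (dia a' b') (u' \<star> v') \<star> W = L (dia a' b') (u' \<star> v' \<star> W) + prepend c (L (dia a' b') (u' \<star> v') \<star> w')
    - vec_prepend (dia (dia a' b') c') (u' \<star> v' \<star> w')"
    unfolding W_def w'_def c'_def by (rule L_star)
  ultimately show ?thesis
    by (simp add: pre module_hom.add[OF lin_prepend] module_hom.diff[OF lin_prepend] a'_def b'_def)
qed

text \<open>
  Since the expansion of a triple product is symmetric in the factors, induction on the total
  length gives invariance under cyclic rotation. Together with commutativity this is
  associativity.
\<close>

lemma star_words_cyclic:
  "basis u \<star> basis v \<star> basis w = basis v \<star> basis w \<star> basis u"
proof (induction "length u + length v + length w" arbitrary: u v w rule: less_induct)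
  case less
  show ?case
  proof (cases "u = [] \<or> v = [] \<or> w = []")
    case True
    then show ?thesis by (auto simp: star_words_commute)
  next
    case False
    then obtain a u' b v' c w' where [simp]: "u = a # u'" "v = b # v'" "w = c # w'"
      by (meson neq_Nil_conv)
    \<comment> \<open>The triple merge is itself invariant under rotation.\<close>
    have e: "dia (dia (basis a) (basis b)) (basis c) = dia (dia (basis b) (basis c)) (basis a)"
      by (metis dia_comm dia_assoc)
    show ?thesis
      unfolding \<open>u = _\<close> \<open>v = _\<close> \<open>w = _\<close> star_triple e
      using less[of u' v w] less[of u v' w] less[of u v w'] less[of u' v' w] less[of u' v w']
        less[of u v' w'] less[of u' v' w'] dia_comm[of "basis c" "basis a"] dia_comm[of "basis b" "basis a"]
      by (simp del: star_basis)
  qed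
qed

lemma star_assoc: "p \<star> q \<star> r = p \<star> (q \<star> r)"
proof -
  have "p \<star> q \<star> basis w = q \<star> basis w \<star> p" for w
  proof (rule bilin_eqI[of "\<lambda>p q. p \<star> q \<star> basis w" "\<lambda>p q. q \<star> basis w \<star> p"])
    show "basis u \<star> basis v \<star> basis w = basis v \<star> basis w \<star> basis u" for u v
      by (rule star_words_cyclic)
  qed (intro lin_ops)+
  then have "p \<star> q \<star> r = q \<star> r \<star> p"
    by (rule lin_eqI[of "\<lambda>r. p \<star> q \<star> r" "\<lambda>r. q \<star> r \<star> p", rotated 2]) (intro lin_ops)+
  also have "q \<star> r \<star> p = p \<star> (q \<star> r)"
    by (rule star_commute)
  finally show ?thesis .
qed

sublocale star: comm_monoid_mset "star dia" "basis []"
  by standard (simp_all add: star_assoc, rule star_commute)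

end

section \<open>The factorisation of words into Lyndon words\<close>

text \<open>
  The order on the factors is the lexicographic one, largest factor first. For Lyndon words this is
  the Chen-Fox-Lyndon normal form; using a multiset of factors makes it insensitive to the order
  in which factors are collected.
\<close>

definition concat_desc :: "'z::linorder list multiset \<Rightarrow> 'z list" where
  "concat_desc M = concat (rev (sorted_list_of_multiset M))"

lemma concat_desc_empty [simp]: "concat_desc {#} = []"
  by (simp add: concat_desc_def)

lemma concat_desc_single [simp]: "concat_desc {#w#} = w"
  by (simp add: concat_desc_def)

lemma mset_concat_desc: "mset (concat_desc M) = \<Sum>\<^sub># (image_mset mset M)"
  unfolding concat_desc_def
  by (metis mset_concat mset_map mset_rev mset_sorted_list_of_multiset sum_mset_sum_list)

lemma length_concat_desc_union: "length (concat_desc (M + N)) = length (concat_desc M) + length (concat_desc N)"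
  unfolding size_mset[symmetric] mset_concat_desc by simp

lemma concat_desc_union:
  assumes "\<And>s t. s \<in># M \<Longrightarrow> t \<in># N \<Longrightarrow> t \<le> s"
  shows "concat_desc (M + N) = concat_desc M @ concat_desc N"
proof -
  let ?sort = sorted_list_of_multiset
  have "?sort (M + N) = sort (?sort N @ ?sort M)"
    by (simp flip: sorted_list_of_multiset_mset add: add.commute)
  also have "\<dots> = ?sort N @ ?sort M"
    using assms by (intro properties_for_sort) (auto simp: sorted_append)
  finally show ?thesis by (simp add: concat_desc_def)
qed

lemma concat_desc_add_max:
  "(\<And>s. s \<in># M \<Longrightarrow> s \<le> l) \<Longrightarrow> concat_desc (add_mset l M) = l @ concat_desc M"
  using concat_desc_union[of "{#l#}" M] by simp

lemma concat_desc_add_min: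
  "(\<And>s. s \<in># M \<Longrightarrow> l \<le> s) \<Longrightarrow> concat_desc (add_mset l M) = concat_desc M @ l"
  using concat_desc_union[of M "{#l#}"] by simp

lemma obtain_min_mset:
  fixes M :: "'a::linorder multiset"
  assumes "M \<noteq> {#}"
  obtains m N where "M = add_mset m N" "\<And>s. s \<in># N \<Longrightarrow> m \<le> s"
  using assms by (metis Min_in Min_le finite_set_mset in_diffD insert_DiffM set_mset_eq_empty_iff)

lemma obtain_max_mset:
  fixes M :: "'a::linorder multiset"
  assumes "M \<noteq> {#}"
  obtains m N where "M = add_mset m N" "\<And>s. s \<in># N \<Longrightarrow> s \<le> m"
  using assms by (metis Max_in Max_ge finite_set_mset in_diffD insert_DiffM set_mset_eq_empty_iff)

text \<open>
  The part of the lexicographic order that is decided at a position inside both words. Unlike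
  the order itself, it survives appending different words to the two sides.
\<close>

definition mismatch_less :: "'z::linorder list \<Rightarrow> 'z list \<Rightarrow> bool" where
  "mismatch_less u v \<longleftrightarrow> (\<exists>c a b x y. u = c @ a # x \<and> v = c @ b # y \<and> a < b)"

lemma append_less_append_iff [simp]: "c @ u < c @ v \<longleftrightarrow> u < (v :: 'z::linorder list)"
  by (induction c) auto

lemma append_le_append_iff [simp]: "c @ u \<le> c @ v \<longleftrightarrow> u \<le> (v :: 'z::linorder list)"
  by (induction c) auto

lemma le_append [simp]: "u \<le> u @ (v :: 'z::linorder list)"
  using append_le_append_iff[of u "[]" v] by (simp del: append_le_append_iff)

lemma mismatch_less_append: "mismatch_less u v \<Longrightarrow> u @ x < v @ y"
  by (auto simp: mismatch_less_def)

lemma less_list_cases: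
  assumes "u < (v :: 'z::linorder list)"
  obtains (prefix) y where "y \<noteq> []" "v = u @ y" | (mismatch) "mismatch_less u v"
proof -
  have "(\<exists>y. y \<noteq> [] \<and> v = u @ y) \<or> mismatch_less u v"
    using assms
  proof (induction u arbitrary: v)
    case Nil
    then show ?case by auto
  next
    case (Cons a u)
    then obtain b v' where v: "v = b # v'" "a < b \<or> a = b \<and> u < v'"
      by (cases v) auto
    show ?case
    proof (cases "a < b")
      case True
      then have "mismatch_less (a # u) v"
        unfolding mismatch_less_def v by (metis append_Nil)
      then show ?thesis ..
    next
      case False
      with v Cons.IH[of v'] have "(\<exists>y. y \<noteq> [] \<and> v' = u @ y) \<or> mismatch_less u v'" "a = b"
        by auto
      then show ?thesis
        unfolding mismatch_less_def v by simp (metis append_Cons)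
    qed
  qed
  then show ?thesis using that by blast
qed

text \<open>
  The word cannot be a prefix of its own proper suffix, so the comparison that defines Lyndon
  words is always decided at a letter.
\<close>

lemma lyndon_mismatch_suffix:
  assumes "lyndon (u @ v)" "u \<noteq> []" "v \<noteq> []"
  shows "mismatch_less (u @ v) v"
proof -
  have "u @ v < v" using assms by (auto simp: lyndon_def)
  then show ?thesis
  proof (cases rule: less_list_cases)
    case (prefix y)
    then have "length v = length (u @ v @ y)" by simp
    with \<open>u \<noteq> []\<close> show ?thesis by simp
  qed
qed

lemma lyndon_nonempty: "lyndon w \<Longrightarrow> w \<noteq> []"
  by (simp add: lyndon_def)

text \<open>
  Split off the smallest nonempty suffix \<open>s\<close>, which is Lyndon because each of its suffixes competes
  with it, and factorise the rest. It remains to see that the smallest factor \<open>m\<close> of the rest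
  is not below \<open>s\<close>: otherwise minimality of \<open>s\<close> against the suffix \<open>m s\<close> forces \<open>s = m x\<close> with
  \<open>x \<le> s\<close>, which contradicts that \<open>s\<close> is Lyndon.
\<close>

lemma lyndon_factorisation_exists:
  assumes "w \<in> lists Z"
  shows "\<exists>M. w = concat_desc M \<and> (\<forall>l\<in>#M. lyndon l \<and> l \<in> lists Z)"
  using assms
proof (induction "length w" arbitrary: w rule: less_induct)
  case less
  show ?case
  proof (cases "w = []")
    case True
    then show ?thesis by (intro exI[of _ "{#}"]) simp
  next
    case False
    define S where "S = {v. v \<noteq> [] \<and> (\<exists>u. w = u @ v)}"
    have "S \<subseteq> set (suffixes w)" by (auto simp: S_def suffix_def)
    then have fin: "finite S" by (rule finite_subset) simp
    have "w \<in> S" using False by (simp add: S_def)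
    define s where "s = Min S"
    have "s \<in> S" unfolding s_def using fin \<open>w \<in> S\<close> by (intro Min_in) auto
    have s_le: "s \<le> v" if "v \<in> S" for v
      unfolding s_def using fin that by simp
    from \<open>s \<in> S\<close> obtain w' where w: "w = w' @ s" and "s \<noteq> []"
      by (auto simp: S_def)
    have "lyndon s"
      unfolding lyndon_def
    proof (intro conjI allI impI \<open>s \<noteq> []\<close>)
      fix x y assume s: "s = x @ y \<and> x \<noteq> [] \<and> y \<noteq> []"
      with w have "y \<in> S" by (auto simp: S_def)
      moreover have "s \<noteq> y" using s by auto
      ultimately show "s < y" using s_le[of y] by simp
    qed
    obtain M where M: "w' = concat_desc M" "\<forall>l\<in>#M. lyndon l \<and> l \<in> lists Z"
      using less w \<open>s \<noteq> []\<close> by (metis append_in_lists_conv length_append less_add_same_cancel1 length_greater_0_conv)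
    have s_min: "s \<le> l" if "l \<in># M" for l
    proof -
      from that obtain m N where N: "M = add_mset m N" "\<And>s. s \<in># N \<Longrightarrow> m \<le> s"
        by (metis obtain_min_mset empty_not_add_mset multi_member_split)
      then have w': "w' = concat_desc N @ m"
        using M(1) by (simp add: concat_desc_add_min)
      have "m \<noteq> []" using M N by (auto dest: lyndon_nonempty)
      with w w' have "m @ s \<in> S" by (auto simp: S_def)
      then have le: "s \<le> m @ s" by (rule s_le)
      have "s \<le> m"
      proof (rule ccontr)
        assume "\<not> s \<le> m"
        then have "m < s" by simp
        then show False
        proof (cases rule: less_list_cases)
          case (prefix x)
          with le have "x \<le> s" by simp
          moreover have "s < x"
            using \<open>lyndon s\<close> prefix \<open>m \<noteq> []\<close> by (auto simp: lyndon_def)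
          ultimately show False by simp
        next
          case mismatch
          from mismatch_less_append[OF this, of s "[]"] le show False by simp
        qed
      qed
      also have "m \<le> l" using that N by auto
      finally show ?thesis .
    qed
    then have "w = concat_desc (add_mset s M)"
      using w M by (simp add: concat_desc_add_min)
    with M \<open>lyndon s\<close> less.prems w show ?thesis
      by (intro exI[of _ "add_mset s M"]) auto
  qed
qed

text \<open>
  A suffix starts inside some factor, and a nonempty suffix of a Lyndon word is at least that word.
  Hence the smallest factor is the smallest nonempty suffix of the whole word, so it can be
  recovered from the word; this gives uniqueness of the factorisation.
\<close>

lemma suffix_ge_min_factor:
  assumes "\<forall>l\<in>#M. lyndon l \<and> m \<le> l" "concat_desc M = u @ v" "v \<noteq> []"
  shows "m \<le> v"
  using assms
proof (induction M arbitrary: u rule: multiset_induct_max)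
  case empty
  then show ?case by simp
next
  case (add x M)
  then have eq: "x @ concat_desc M = u @ v"
    by (simp add: concat_desc_add_max)
  consider u' where "u' @ v = concat_desc M" | us where "x = u @ us" "us \<noteq> []" "v = us @ concat_desc M"
    using eq by (auto simp: append_eq_append_conv2) (metis append_Nil append_Nil2)
  then show ?case
  proof cases
    case 1
    with add show ?thesis by (metis insert_iff set_mset_add_mset_insert)
  next
    case 2
    have "m \<le> x" using add.prems by simp
    also have "x \<le> us"
      using add.prems 2 by (cases "u = []") (auto simp: lyndon_def less_imp_le)
    also have "us \<le> v" using 2 by simp
    finally show ?thesis .
  qed
qed

lemma lyndon_factorisation_unique:
  assumes "\<forall>l\<in>#M. lyndon l" "\<forall>l\<in>#N. lyndon l" "concat_desc M = concat_desc N"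
  shows "M = N"
  using assms
proof (induction M arbitrary: N rule: multiset_induct_min)
  case empty
  show ?case
  proof (rule ccontr)
    assume "{#} \<noteq> N"
    then obtain n N' where "N = add_mset n N'" "\<And>s. s \<in># N' \<Longrightarrow> n \<le> s"
      using obtain_min_mset by metis
    with empty show False by (auto simp: concat_desc_add_min dest: lyndon_nonempty)
  qed
next
  case (add m M)
  have "m \<noteq> []" using add.prems by (auto dest: lyndon_nonempty)
  have M: "concat_desc (add_mset m M) = concat_desc M @ m"
    using add.hyps by (simp add: concat_desc_add_min)
  with \<open>m \<noteq> []\<close> add.prems have "N \<noteq> {#}" by auto
  then obtain n N' where N: "N = add_mset n N'" "\<And>s. s \<in># N' \<Longrightarrow> n \<le> s"
    using obtain_min_mset by metis
  have "n \<noteq> []" using add.prems N by (auto dest: lyndon_nonempty)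
  have N': "concat_desc N = concat_desc N' @ n"
    using N by (simp add: concat_desc_add_min)
  have "m \<le> n"
    using suffix_ge_min_factor[of "add_mset m M" m "concat_desc N'" n] add.prems add.hyps N' \<open>n \<noteq> []\<close>
    by auto
  moreover have "n \<le> m"
    using suffix_ge_min_factor[of N n "concat_desc M" m] add.prems M N \<open>m \<noteq> []\<close> by auto
  ultimately have "m = n" by simp
  with M N' add.prems N add.IH[of N'] show ?case by simp
qed

section \<open>The largest shuffle of Lyndon words\<close>

lemma append_in_shuffles: "u @ v \<in> shuffles u v"
  by (induction u) (auto intro: Cons_in_shuffles_leftI)

text \<open>
  Forgetting that the letters of \<open>x\<close> come before those of \<open>y\<close> only enlarges the set of shuffles.
\<close>

lemma shuffles_append_left:
  "z \<in> shuffles (x @ y) w \<Longrightarrow> \<exists>r\<in>shuffles y w. z \<in> shuffles x r"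
proof (induction z arbitrary: x w)
  case Nil
  then show ?case by auto
next
  case (Cons a z)
  show ?case
  proof (cases "x = []")
    case True
    with Cons.prems show ?thesis by auto
  next
    case False
    then obtain b x' where x: "x = b # x'" by (cases x) auto
    from Cons.prems x consider "b = a" "z \<in> shuffles (x' @ y) w"
      | w' where "w = a # w'" "z \<in> shuffles (x @ y) w'"
      by (cases w) (auto simp: Cons_in_shuffles_iff)
    then show ?thesis
    proof cases
      case 1
      with Cons.IH x show ?thesis by (blast intro: Cons_in_shuffles_leftI)
    next
      case 2
      with Cons.IH x show ?thesis by (blast intro: Cons_in_shuffles_rightI)
    qed
  qed
qed

text \<open>
  Use the same positions for the letters of \<open>w\<close> as for those of \<open>v\<close>. The two shuffles then
  first differ where \<open>v\<close> and \<open>w\<close> first differ.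
\<close>

lemma shuffles_strict_mono:
  assumes "z \<in> shuffles u v" "v < w" "length v = length w"
  shows "\<exists>z'\<in>shuffles u w. z < (z' :: 'z::linorder list)"
  using assms
proof (induction z arbitrary: u v w)
  case Nil
  then show ?case by auto
next
  case (Cons c z)
  from Cons.prems obtain b v' b' w' where vw: "v = b # v'" "w = b' # w'"
    by (cases v; cases w) auto
  from Cons.prems vw consider u' where "u = c # u'" "z \<in> shuffles u' v"
    | "c = b" "z \<in> shuffles u v'"
    by (cases u) (auto simp: Cons_in_shuffles_iff)
  then show ?case
  proof cases
    case 1
    with Cons obtain z' where "z' \<in> shuffles u' w" "z < z'" by blast
    with 1 show ?thesis by (intro bexI[of _ "c # z'"]) (auto intro: Cons_in_shuffles_leftI)
  next
    case 2
    show ?thesis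
    proof (cases "b < b'")
      case True
      with 2 vw append_in_shuffles[of u w'] show ?thesis
        by (intro bexI[of _ "b' # u @ w'"]) (auto intro: Cons_in_shuffles_rightI)
    next
      case False
      with Cons 2 vw obtain z' where "z' \<in> shuffles u w'" "z < z'" "b = b'" by fastforce
      with 2 vw show ?thesis by (intro bexI[of _ "b # z'"]) (auto intro: Cons_in_shuffles_rightI)
    qed
  qed
qed

text \<open>
  If \<open>p\<close> is not a prefix of \<open>m\<close>, the comparison is decided inside \<open>p\<close>. If \<open>m = p r\<close>, then what
  is compared after \<open>p\<close> is \<open>m\<close> with its proper suffix \<open>r\<close>, which is larger at a letter.
\<close>

lemma lyndon_first:
  assumes "lyndon m" "p \<noteq> []" "p @ q < m"
  shows "p @ m @ x < m @ y"
proof -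
  consider (prefix) r where "r \<noteq> []" "m = p @ r" | (mismatch) "mismatch_less p m"
    using assms(3)
  proof (cases rule: less_list_cases)
    case (prefix r)
    with that(1)[of "q @ r"] show ?thesis by simp
  next
    case mismatch
    then obtain c a b s t where pq: "p @ q = c @ a # s" and m: "m = c @ b # t" and "a < b"
      unfolding mismatch_less_def by blast
    from pq have "(\<exists>us. c = p @ us) \<or> (\<exists>us. p = c @ a # us)"
      by (auto simp: append_eq_append_conv2 append_eq_Cons_conv)
    then show ?thesis
    proof (elim disjE exE)
      fix us assume "c = p @ us"
      with that(1)[of "us @ b # t"] m show ?thesis by simp
    next
      fix us assume "p = c @ a # us"
      then have "mismatch_less p m"
        unfolding mismatch_less_def using m \<open>a < b\<close> by blast
      then show ?thesis by (rule that(2))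
    qed
  qed
  then show ?thesis
  proof cases
    case prefix
    with lyndon_mismatch_suffix[of p r] assms have "mismatch_less m r" by simp
    then have "m @ x < r @ y" by (rule mismatch_less_append)
    with prefix show ?thesis by simp
  next
    case mismatch
    from mismatch_less_append[OF this, of "m @ x" y] show ?thesis by simp
  qed
qed

text \<open>
  The smallest factor of the tail is a proper suffix of the Lyndon word.
\<close>

lemma lyndon_less_tail_factor:
  assumes "lyndon (a # concat_desc T)" "\<forall>s\<in>#T. lyndon s" "s \<in># T"
  shows "a # concat_desc T < s"
proof -
  obtain m N where T: "T = add_mset m N" "\<And>s. s \<in># N \<Longrightarrow> m \<le> s"
    by (metis assms(3) obtain_min_mset empty_iff set_mset_empty)
  have "m \<noteq> []" using assms T by (auto dest: lyndon_nonempty)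
  have "a # concat_desc T = (a # concat_desc N) @ m"
    using T by (simp add: concat_desc_add_min)
  then have "a # concat_desc T < m"
    using assms(1) \<open>m \<noteq> []\<close> unfolding lyndon_def by blast
  also have "m \<le> s" using assms(3) T by auto
  finally show ?thesis .
qed

text \<open>
  This is what happens to the bound when the first letter of a Lyndon factor \<open>l = a t\<close> is
  used up, with \<open>t\<close> factorised into \<open>T\<close>. If \<open>l\<close> is the largest
  factor, both words agree, since the factors of \<open>t\<close> exceed \<open>l\<close>. Otherwise let \<open>m\<close> be the
  largest factor; the left word is \<open>p m\<close> followed by something, where \<open>p\<close> is the prefix of \<open>l\<close> that
  ends before the first factor of \<open>t\<close> below \<open>m\<close>, while the right word begins with \<open>m\<close>.
\<close>

lemma Cons_concat_desc_le:
  assumes l: "lyndon (a # concat_desc T)" and T: "\<forall>s\<in>#T. lyndon s" and M: "\<forall>s\<in>#M. lyndon s"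
  shows "a # concat_desc (T + M) \<le> concat_desc (add_mset (a # concat_desc T) M)"
proof (cases "\<forall>s\<in>#M. s \<le> a # concat_desc T")
  case True
  then have "t \<le> s" if "s \<in># T" "t \<in># M" for s t
    using that lyndon_less_tail_factor[OF l T] by force
  then have "concat_desc (T + M) = concat_desc T @ concat_desc M"
    by (intro concat_desc_union)
  with True show ?thesis by (simp add: concat_desc_add_max)
next
  case False
  then have "M \<noteq> {#}" by auto
  then obtain m N where N: "M = add_mset m N" "\<And>s. s \<in># N \<Longrightarrow> s \<le> m"
    using obtain_max_mset by metis
  with False have less: "a # concat_desc T < m" by force
  define H where "H = {#s \<in># T. m \<le> s#}"
  define K where "K = {#s \<in># T. \<not> m \<le> s#}"
  have TH: "T = H + K" by (simp add: H_def K_def)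
  have "concat_desc T = concat_desc H @ concat_desc K"
    unfolding TH by (rule concat_desc_union) (auto simp: H_def K_def)
  with less have "(a # concat_desc H) @ concat_desc K < m" by simp
  then have "(a # concat_desc H) @ m @ concat_desc (K + N) < m @ concat_desc (add_mset (a # concat_desc T) N)"
    using M N by (intro lyndon_first) auto
  moreover have "concat_desc (add_mset (a # concat_desc T) M) = m @ concat_desc (add_mset (a # concat_desc T) N)"
  proof -
    have "concat_desc (add_mset m (add_mset (a # concat_desc T) N)) = m @ concat_desc (add_mset (a # concat_desc T) N)"
      using N less by (intro concat_desc_add_max) auto
    then show ?thesis by (simp add: N add_mset_commute)
  qed
  moreover have "concat_desc (T + M) = concat_desc H @ m @ concat_desc (K + N)"
  proof -
    have "T + M = H + add_mset m (K + N)" using TH N by simp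
    moreover have "concat_desc (H + add_mset m (K + N)) = concat_desc H @ concat_desc (add_mset m (K + N))"
      using N by (intro concat_desc_union) (auto simp: H_def K_def dest: order_trans)
    moreover have "concat_desc (add_mset m (K + N)) = m @ concat_desc (K + N)"
      using N by (intro concat_desc_add_max) (auto simp: K_def)
    ultimately show ?thesis by simp
  qed
  ultimately show ?thesis by simp
qed

text \<open>
  The induction follows the first letter of the shuffle. It comes from the largest factor \<open>a t\<close> of one
  of the two words. The rest \<open>z'\<close> of the shuffle is a shuffle of \<open>t\<close> with a shuffle of all other
  factors; replacing the latter by its maximum, and then factorising \<open>t\<close>, bounds \<open>z'\<close> by a
  sorted concatenation to which the previous lemma applies.
\<close>

lemma shuffles_le_concat_desc:
  assumes "\<forall>s\<in>#M. lyndon s" "\<forall>s\<in>#N. lyndon s" "z \<in> shuffles (concat_desc M) (concat_desc N)"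
  shows "z \<le> concat_desc (M + N)"
  using assms
proof (induction "length z" arbitrary: z M N rule: less_induct)
  case less
  have main: "a # z' \<le> concat_desc (M + N)"
    if z': "z = a # z'" "concat_desc M = a # r" "z' \<in> shuffles r (concat_desc N)"
      and M: "\<forall>s\<in>#M. lyndon s" and N: "\<forall>s\<in>#N. lyndon s" for a z' r M N
  proof -
    have "M \<noteq> {#}" using z' by auto
    then obtain l R where R: "M = add_mset l R" "\<And>s. s \<in># R \<Longrightarrow> s \<le> l"
      using obtain_max_mset by metis
    then have "l \<noteq> []" using M by (auto dest: lyndon_nonempty)
    moreover have "l @ concat_desc R = a # r"
      using R z' by (simp add: concat_desc_add_max)
    ultimately obtain t where l: "l = a # t" "r = t @ concat_desc R"
      by (cases l) auto
    with z' obtain y where y: "y \<in> shuffles (concat_desc R) (concat_desc N)" "z' \<in> shuffles t y"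
      using shuffles_append_left by blast
    have "y \<le> concat_desc (R + N)"
      using y z' M N R by (intro less.hyps) (auto simp: length_shuffles)
    moreover have "length y = length (concat_desc (R + N))"
      using y by (simp add: length_shuffles length_concat_desc_union)
    ultimately obtain z'' where z'': "z'' \<in> shuffles t (concat_desc (R + N))" "z' \<le> z''"
      using y(2) shuffles_strict_mono[OF y(2)] by (metis le_less order_refl)
    obtain T where T: "t = concat_desc T" "\<forall>s\<in>#T. lyndon s"
      using lyndon_factorisation_exists[of t UNIV] by auto
    have "length z'' < length z"
      using z'' y z' length_shuffles[OF z''(1)] length_shuffles[OF y(2)] \<open>length y = _\<close> by simp
    then have "z'' \<le> concat_desc (T + (R + N))"
      using z'' T M N R by (intro less.hyps) auto
    with z'' have "a # z' \<le> a # concat_desc (T + (R + N))" by simp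
    also have "\<dots> \<le> concat_desc (add_mset l (R + N))"
      using Cons_concat_desc_le[of a T "R + N"] T M N R l by auto
    finally show ?thesis using R by simp
  qed
  show ?case
  proof (cases z)
    case (Cons a z')
    with less.prems(3) consider r where "concat_desc M = a # r" "z' \<in> shuffles r (concat_desc N)"
      | r where "concat_desc N = a # r" "z' \<in> shuffles (concat_desc M) r"
      by (cases "concat_desc M"; cases "concat_desc N") (auto simp: Cons_in_shuffles_iff)
    then show ?thesis
    proof cases
      case 1
      with main[of a z' M _ N] Cons less.prems show ?thesis by simp
    next
      case 2
      with main[of a z' N _ M] Cons less.prems show ?thesis
        by (simp add: shuffles_commutes add.commute)
    qed
  qed simp
qed

section \<open>Triangular maps\<close>

lemma in_keys_lin_extE:
  assumes "b \<in> keys (lin_ext f p)"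
  obtains a where "a \<in> keys p" "b \<in> keys (f a)"
proof -
  from assms have "(\<Sum>a\<in>keys p. lookup p a * lookup (f a) b) \<noteq> 0"
    by (simp add: in_keys_iff lookup_lin_ext[of "keys p"])
  then obtain a where "a \<in> keys p" "lookup p a * lookup (f a) b \<noteq> 0"
    by (rule sum.not_neutral_contains_not_neutral)
  then show ?thesis
    by (intro that[of a]) (simp_all add: in_keys_iff)
qed

lemma lin_ext_cong: "(\<And>a. a \<in> keys p \<Longrightarrow> f a = g a) \<Longrightarrow> lin_ext f p = lin_ext g p"
  by (simp add: lin_ext_def)

lemma lin_ext_in_free_space:
  assumes "p \<in> free_space S" "\<And>a. a \<in> S \<Longrightarrow> f a \<in> free_space T"
  shows "lin_ext f p \<in> free_space T"
  unfolding free_space_def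
proof (intro CollectI subsetI)
  fix b assume "b \<in> keys (lin_ext f p)"
  then obtain a where "a \<in> keys p" "b \<in> keys (f a)" by (rule in_keys_lin_extE)
  with assms show "b \<in> T" unfolding free_space_def by blast
qed

lemma free_space_closed:
  shows "0 \<in> free_space S"
    and "p \<in> free_space S \<Longrightarrow> q \<in> free_space S \<Longrightarrow> p + q \<in> free_space S"
    and "p \<in> free_space S \<Longrightarrow> q \<in> free_space S \<Longrightarrow> p - q \<in> free_space S"
    and "p \<in> free_space S \<Longrightarrow> scale c p \<in> free_space S"
    and "basis a \<in> free_space S \<longleftrightarrow> a \<in> S"
proof -
  have "keys (scale c p) \<subseteq> keys p" by (auto simp: in_keys_iff)
  then show "p \<in> free_space S \<Longrightarrow> scale c p \<in> free_space S"
    by (auto simp: free_space_def)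
qed (use keys_add[of p q] keys_diff[of p q] in \<open>auto simp: free_space_def\<close>)

text \<open>
  In a nonzero element of the kernel, pick an index in the support whose leading word has
  maximal rank. No other term can cancel this word: its leading word would be of larger rank, or equal,
  against injectivity of \<open>lead\<close>. Surjectivity is by induction on the rank: each basis vector is
  the image of a basis vector, up to scaling and words of smaller rank.
\<close>

lemma triangular_bij_betw:
  fixes f :: "'i \<Rightarrow> ('b \<Rightarrow>\<^sub>0 rat)" and rank :: "'b \<Rightarrow> 'o::wellorder"
  assumes lead: "bij_betw lead S T"
    and keys: "\<And>i. i \<in> S \<Longrightarrow> keys (f i) \<subseteq> T"
    and nonzero: "\<And>i. i \<in> S \<Longrightarrow> lookup (f i) (lead i) \<noteq> 0"
    and smaller: "\<And>i w. i \<in> S \<Longrightarrow> w \<in> keys (f i) \<Longrightarrow> w \<noteq> lead i \<Longrightarrow> rank w < rank (lead i)"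
  shows "bij_betw (lin_ext f) (free_space S) (free_space T)"
proof -
  note lin = module_hom.add[OF lin_lin_ext] module_hom.diff[OF lin_lin_ext]
    module_hom.scale[OF lin_lin_ext] module_hom.zero[OF lin_lin_ext]
  have kernel: "p = 0" if p: "p \<in> free_space S" "lin_ext f p = 0" for p
  proof (rule ccontr)
    assume "p \<noteq> 0"
    define R where "R = (\<lambda>i. rank (lead i)) ` keys p"
    have "finite R" "R \<noteq> {}" using \<open>p \<noteq> 0\<close> by (auto simp: R_def)
    then obtain i where i: "i \<in> keys p" "rank (lead i) = Max R"
      using Max_in[of R] unfolding R_def by (metis imageE)
    have max: "rank (lead j) \<le> rank (lead i)" if "j \<in> keys p" for j
      using that \<open>finite R\<close> i(2) by (auto simp: R_def)
    have S: "keys p \<subseteq> S" using p by (simp add: free_space_def)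
    have "lookup (f j) (lead i) = 0" if "j \<in> keys p - {i}" for j
    proof (rule ccontr)
      assume "lookup (f j) (lead i) \<noteq> 0"
      moreover have "lead i \<noteq> lead j"
        using lead that i S by (auto simp: bij_betw_def inj_on_def)
      ultimately have "rank (lead i) < rank (lead j)"
        using smaller[of j "lead i"] that S by (auto simp: in_keys_iff)
      with max[of j] that show False by auto
    qed
    then have "lookup (lin_ext f p) (lead i) = lookup p i * lookup (f i) (lead i)"
      using i(1) by (simp add: lookup_lin_ext[of "keys p"] sum.remove)
    moreover have "lookup p i * lookup (f i) (lead i) \<noteq> 0"
      using i(1) S nonzero[of i] by (auto simp: in_keys_iff)
    ultimately show False using p(2) by simp
  qed
  have "inj_on (lin_ext f) (free_space S)"
  proof (rule inj_onI)
    fix p q assume "p \<in> free_space S" "q \<in> free_space S" "lin_ext f p = lin_ext f q"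
    then show "p = q"
      using kernel[of "p - q"] by (simp add: lin free_space_closed)
  qed
  have into: "lin_ext f p \<in> free_space T" if "p \<in> free_space S" for p
    using keys by (intro lin_ext_in_free_space[OF that]) (simp add: free_space_def)
  \<comment> \<open>The image is a subspace, so it contains a vector as soon as it contains the basis vectors of its support.\<close>
  have closed: "q \<in> lin_ext f ` free_space S"
    if "\<And>w. w \<in> keys q \<Longrightarrow> basis w \<in> lin_ext f ` free_space S" for q
  proof -
    have "\<forall>w\<in>keys q. \<exists>p. p \<in> free_space S \<and> basis w = lin_ext f p"
      using that by (auto simp: image_iff)
    then obtain g where g: "\<forall>w\<in>keys q. g w \<in> free_space S \<and> basis w = lin_ext f (g w)"
      by (rule bchoice[THEN exE])
    have "lin_ext f (\<Sum>w\<in>keys q. scale (lookup q w) (g w)) = (\<Sum>w\<in>keys q. scale (lookup q w) (basis w))"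
      using g by (simp add: module_hom.sum[OF lin_lin_ext] lin)
    moreover have "(\<Sum>w\<in>keys q. scale (lookup q w) (g w)) \<in> free_space S"
      using lin_ext_in_free_space[of q "keys q" g S] g by (simp add: lin_ext_def free_space_def)
    ultimately show ?thesis unfolding basis_expansion by (rule image_eqI[OF sym])
  qed
  have base: "basis w \<in> lin_ext f ` free_space S" if "w \<in> T" for w
    using that
  proof (induction "rank w" arbitrary: w rule: less_induct)
    case less
    then obtain i where i: "i \<in> S" "lead i = w"
      using lead by (auto simp: bij_betw_def)
    define c where "c = lookup (f i) w"
    have "c \<noteq> 0" using nonzero i by (auto simp: c_def)
    define r where "r = f i - scale c (basis w)"
    have "basis v \<in> lin_ext f ` free_space S" if "v \<in> keys r" for v
    proof (rule less.hyps)
      have "v \<noteq> w" using that by (auto simp: r_def c_def in_keys_iff lookup_minus lookup_basis)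
      moreover from this have v: "v \<in> keys (f i)"
        using that by (auto simp: r_def in_keys_iff lookup_minus lookup_basis)
      ultimately show "rank v < rank w" using smaller i by auto
      show "v \<in> T" using v keys i by auto
    qed
    then obtain p where p: "p \<in> free_space S" "r = lin_ext f p"
      using closed[of r] by auto
    have "basis w = scale (1 / c) (f i - r)"
      using \<open>c \<noteq> 0\<close> by (simp add: r_def scale_simps)
    also have "\<dots> = lin_ext f (scale (1 / c) (basis i - p))"
      by (simp add: lin p)
    finally show ?case
      using p i by (auto intro!: imageI simp: free_space_closed)
  qed
  have "lin_ext f ` free_space S = free_space T"
  proof (intro equalityI subsetI)
    fix q assume "q \<in> free_space T"
    then show "q \<in> lin_ext f ` free_space S"
      by - (rule closed, rule base, auto simp: free_space_def)
  qed (use into in blast)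
  with \<open>inj_on (lin_ext f) (free_space S)\<close> show ?thesis
    by (simp add: bij_betw_def)
qed

section \<open>Leading words of products of Lyndon words\<close>

text \<open>
  The alphabet need not be well-ordered, so neither are words of a fixed length. The order
  is therefore restricted to rearrangements of the same letters, of which there are finitely many;
  words containing merged letters are shorter and are covered by the first alternative.
\<close>

definition precedes :: "'z::linorder list \<Rightarrow> 'z list \<Rightarrow> bool" (infix \<open>\<prec>\<close> 50) where
  "v \<prec> w \<longleftrightarrow> length v < length w \<or> (mset v = mset w \<and> v < w)"

definition word_rank :: "'z::linorder list \<Rightarrow> nat \<times> nat" where
  "word_rank w = (length w, card {v. mset v = mset w \<and> v < w})"

lemma precedes_word_rank:
  assumes "v \<prec> w"
  shows "word_rank v < word_rank w"
proof (cases "length v < length w")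
  case False
  with assms have vw: "mset v = mset w" "v < w" by (auto simp: precedes_def)
  have "finite {u. mset u = mset w \<and> u < w}"
    by (rule finite_subset[OF _ mset_eq_finite[of w]]) auto
  moreover have "{u. mset u = mset v \<and> u < v} \<subset> {u. mset u = mset w \<and> u < w}"
    using vw by auto
  ultimately have "card {u. mset u = mset v \<and> u < v} < card {u. mset u = mset w \<and> u < w}"
    by (rule psubset_card_mono)
  moreover have "length v = length w" using vw by (metis size_mset)
  ultimately show ?thesis by (simp add: word_rank_def)
qed (simp add: word_rank_def)

lemma lookup_prepend_Cons: "lookup (prepend a p) (x # z) = (if a = x then lookup p z else 0)"
proof (cases "a = x")
  case True
  have "lookup (prepend a p) (x # z) = (\<Sum>w\<in>keys p. if w = z then lookup p w else 0)"
    unfolding prepend_def lookup_lin_ext[OF finite_keys order_refl]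
    using True by (intro sum.cong) (auto simp: lookup_basis)
  with True show ?thesis by (simp add: in_keys_iff)
next
  case False
  then show ?thesis
    unfolding prepend_def lookup_lin_ext[OF finite_keys order_refl] by (simp add: lookup_basis)
qed

lemma keys_L_map_length:
  assumes "z \<in> keys (L_map dia c p)"
  shows "\<exists>w\<in>keys p. length w = length z"
proof -
  from assms obtain w where w: "w \<in> keys p"
    "z \<in> keys (case w of [] \<Rightarrow> 0 | x # v \<Rightarrow> vec_word (dia c (basis x)) v)"
    unfolding L_map_def by (rule in_keys_lin_extE)
  then obtain x v where x: "w = x # v" "z \<in> keys (vec_word (dia c (basis x)) v)"
    by (cases w) (auto simp del: vec_word_eq)
  from x(2) obtain y where "z \<in> keys (basis (y # v) :: 'a list \<Rightarrow>\<^sub>0 rat)"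
    unfolding vec_word_def by (rule in_keys_lin_extE)
  with w x(1) show ?thesis by (intro bexI[of _ w]) auto
qed

text \<open>
  The merging term of the recursion replaces the first letter in words of the product of the
  two tails, and thus stays below full length. Words of full length come from the shuffle part
  of the recursion alone, and there no cancellation can occur because the two contributions are nonnegative.
\<close>

lemma star_words_top:
  assumes "length u + length v \<le> length z"
  shows "lookup (star_words dia u v) z \<ge> 0 \<and> (lookup (star_words dia u v) z \<noteq> 0 \<longleftrightarrow> z \<in> shuffles u v)"
  using assms
proof (induction dia u v arbitrary: z rule: star_words.induct)
  case (3 dia a u b v)
  then obtain x z' where z: "z = x # z'" by (cases z) auto
  have "lookup (L_map dia (dia (basis a) (basis b)) (star_words dia u v)) z = 0"
  proof (rule ccontr)
    assume "lookup (L_map dia (dia (basis a) (basis b)) (star_words dia u v)) z \<noteq> 0"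
    then obtain w where w: "w \<in> keys (star_words dia u v)" "length w = length z"
      using keys_L_map_length by (metis in_keys_iff)
    with 3 have "w \<in> shuffles u v" by (auto simp: in_keys_iff)
    with w 3 show False by (auto dest: length_shuffles)
  qed
  then have "lookup (star_words dia (a # u) (b # v)) z =
      (if a = x then lookup (star_words dia u (b # v)) z' else 0) +
      (if b = x then lookup (star_words dia (a # u) v) z' else 0)"
    by (simp add: z lookup_add lookup_minus lookup_prepend_Cons)
  with 3(1,2)[of z'] 3(4) show ?case
    by (auto simp: z add_nonneg_eq_0_iff)
qed (auto simp: lookup_basis)

lemma star_basis_left: "star dia (basis l) p = lin_ext (star_words dia l) p"
  by (simp add: star_def)

text \<open>
  Words of \<open>p\<close> below the leading one cannot reach the new leading word: shorter ones yield shorter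
  words, and a smaller rearrangement \<open>v\<close> yields shuffles that are strictly below some shuffle
  of \<open>l\<close> with the leading word of \<open>p\<close>, all of which are at most the new leading word. The latter does occur,
  since for the largest factor \<open>l\<close> it is \<open>l\<close> followed by the old leading word.
\<close>

lemma star_leading_word:
  fixes l :: "'z::linorder list"
  assumes l: "lyndon l" "\<And>s. s \<in># M \<Longrightarrow> s \<le> l" and M: "\<forall>s\<in>#M. lyndon s"
    and pos: "lookup p (concat_desc M) > 0"
    and lead: "\<And>w. w \<in> keys p \<Longrightarrow> w \<noteq> concat_desc M \<Longrightarrow> w \<prec> concat_desc M"
  defines "m \<equiv> concat_desc (add_mset l M)"
  shows "lookup (star dia (basis l) p) m > 0"
    and "\<And>w. w \<in> keys (star dia (basis l) p) \<Longrightarrow> w \<noteq> m \<Longrightarrow> w \<prec> m"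
proof -
  have m: "m = l @ concat_desc M"
    unfolding m_def using l by (intro concat_desc_add_max)
  have less: "z < m" if v: "mset v = mset (concat_desc M)" "v < concat_desc M" and z: "z \<in> shuffles l v" for v z
  proof -
    have "length v = length (concat_desc M)" using v by (metis size_mset)
    with shuffles_strict_mono[OF z v(2)] obtain z' where "z' \<in> shuffles l (concat_desc M)" "z < z'"
      by auto
    moreover from this have "z' \<le> m"
      using shuffles_le_concat_desc[of "{#l#}" M z'] l M by (simp add: m_def)
    ultimately show ?thesis by simp
  qed
  have "lookup (star_words dia l v) m = 0" if "v \<in> keys p - {concat_desc M}" for v
  proof (rule ccontr)
    assume nz: "lookup (star_words dia l v) m \<noteq> 0"
    from that lead have "v \<prec> concat_desc M" by auto
    then have *: "length v \<le> length (concat_desc M)"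
      by (auto simp: precedes_def) (metis order_refl size_mset)
    with nz star_words_top[of l v m dia] have "m \<in> shuffles l v" by (simp add: m)
    moreover from this have "length v = length (concat_desc M)"
      by (auto simp: m dest: length_shuffles)
    ultimately show False
      using less[of v m] \<open>v \<prec> concat_desc M\<close> by (auto simp: precedes_def)
  qed
  moreover have "concat_desc M \<in> keys p" using pos by (simp add: in_keys_iff)
  ultimately have "lookup (star dia (basis l) p) m =
      lookup p (concat_desc M) * lookup (star_words dia l (concat_desc M)) m"
    by (simp add: star_basis_left lookup_lin_ext[of "keys p"] sum.remove)
  moreover have "lookup (star_words dia l (concat_desc M)) m > 0"
    using star_words_top[of l "concat_desc M" m dia] append_in_shuffles[of l "concat_desc M"]
    by (simp add: m order_less_le)
  ultimately show "lookup (star dia (basis l) p) m > 0"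
    using pos by simp
  fix w assume w: "w \<in> keys (star dia (basis l) p)" "w \<noteq> m"
  then obtain v where v: "v \<in> keys p" "w \<in> keys (star_words dia l v)"
    unfolding star_basis_left by (elim in_keys_lin_extE)
  show "w \<prec> m"
  proof (cases "length w < length m")
    case False
    from v(1) lead consider "v = concat_desc M" | "length v < length (concat_desc M)"
      | "mset v = mset (concat_desc M)" "v < concat_desc M"
      unfolding precedes_def by blast
    note cases = this
    then have "length v \<le> length (concat_desc M)"
      by cases (auto dest: arg_cong[of _ _ size])
    with False have "length l + length v \<le> length w" by (simp add: m)
    with star_words_top[of l v w dia] v have sh: "w \<in> shuffles l v"
      by (simp add: in_keys_iff)
    from cases show ?thesis
    proof cases
      case 1
      with shuffles_le_concat_desc[of "{#l#}" M w] sh l M have "w \<le> m" by (simp add: m_def)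
      with w have "w < m" by simp
      moreover have "mset w = mset m" using sh 1 by (simp add: m mset_shuffles)
      ultimately show ?thesis by (simp add: precedes_def)
    next
      case 2
      with sh False show ?thesis by (simp add: m length_shuffles)
    next
      case 3
      with less[OF 3 sh] sh show ?thesis by (simp add: precedes_def m mset_shuffles)
    qed
  qed (simp add: precedes_def)
qed

section \<open>Restriction to the alphabet\<close>

definition project :: "'a set \<Rightarrow> ('a \<Rightarrow>\<^sub>0 rat) \<Rightarrow> ('a \<Rightarrow>\<^sub>0 rat)" where
  "project Z = lin_ext (\<lambda>a. if a \<in> Z then basis a else 0)"

lemma project_in_free_space: "project Z p \<in> free_space Z"
  unfolding project_def
  by (rule lin_ext_in_free_space[of _ UNIV]) (auto simp: free_space_def)

lemma project_id: "p \<in> free_space Z \<Longrightarrow> project Z p = p"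
  unfolding project_def free_space_def
  by (rule lin_eqI[OF lin_lin_ext lin_id]) auto

text \<open>
  The projection is the identity on the span of the alphabet, where all values of the letter product
  lie, so associativity is inherited.
\<close>

lemma letter_algebra_project:
  fixes dia :: "('z \<Rightarrow>\<^sub>0 rat) \<Rightarrow> ('z \<Rightarrow>\<^sub>0 rat) \<Rightarrow> ('z \<Rightarrow>\<^sub>0 rat)"
  assumes "bilinear_on (free_space Z) dia"
    and "\<forall>p\<in>free_space Z. \<forall>q\<in>free_space Z. dia p q = dia q p"
    and "\<forall>p\<in>free_space Z. \<forall>q\<in>free_space Z. \<forall>r\<in>free_space Z. dia (dia p q) r = dia p (dia q r)"
  shows "letter_algebra (\<lambda>p q. dia (project Z p) (project Z q))"
proof (rule letter_algebra.intro)
  note P = project_in_free_space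
  have lin: "lin (project Z)" unfolding project_def by (rule lin_lin_ext)
  have closed: "dia p q \<in> free_space Z" if "p \<in> free_space Z" "q \<in> free_space Z" for p q
    using assms(1) that by (simp add: bilinear_on_def)
  fix c d e :: "'z \<Rightarrow>\<^sub>0 rat"
  show "lin (\<lambda>q. dia (project Z c) (project Z q))"
    using assms(1) by (intro linI)
      (simp_all add: bilinear_on_def P module_hom.add[OF lin] module_hom.scale[OF lin])
  show "dia (project Z c) (project Z d) = dia (project Z d) (project Z c)"
    using assms(2) P by blast
  show "dia (project Z (dia (project Z c) (project Z d))) (project Z e) =
      dia (project Z c) (project Z (dia (project Z d) (project Z e)))"
    using assms(3)[rule_format, OF P P P] by (simp only: project_id[OF closed[OF P P]])
qed

lemma L_map_in_free_space:
  assumes "c \<in> free_space Z" "p \<in> free_space (lists Z)"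
    and "\<And>x y. x \<in> free_space Z \<Longrightarrow> y \<in> free_space Z \<Longrightarrow> dia x y \<in> free_space Z"
  shows "L_map dia c p \<in> free_space (lists Z)"
  unfolding L_map_def
proof (rule lin_ext_in_free_space[OF assms(2)])
  fix w assume w: "w \<in> lists Z"
  show "(case w of [] \<Rightarrow> 0 | x # v \<Rightarrow> vec_word (dia c (basis x)) v) \<in> free_space (lists Z)"
  proof (cases w)
    case (Cons x v)
    then have "dia c (basis x) \<in> free_space Z"
      using w assms(1) by (intro assms(3)) (simp_all add: free_space_closed)
    then have "vec_word (dia c (basis x)) v \<in> free_space (lists Z)"
      unfolding vec_word_def
      by (rule lin_ext_in_free_space) (use w Cons in \<open>simp add: free_space_closed\<close>)
    with Cons show ?thesis by (simp del: vec_word_eq)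
  qed (simp add: free_space_closed)
qed

text \<open>
  On words over the alphabet the recursion only applies the letter product to vectors in the span of
  the alphabet, where the projection changes nothing.
\<close>

lemma star_words_project:
  assumes closed: "\<And>x y. x \<in> free_space Z \<Longrightarrow> y \<in> free_space Z \<Longrightarrow> dia x y \<in> free_space Z"
    and "u \<in> lists Z" "v \<in> lists Z"
  shows "star_words (\<lambda>p q. dia (project Z p) (project Z q)) u v = star_words dia u v
    \<and> star_words dia u v \<in> free_space (lists Z)"
proof -
  define dia' where "dia' = (\<lambda>p q. dia (project Z p) (project Z q))"
  have L: "L_map dia' c p = L_map dia c p" if "c \<in> free_space Z" "p \<in> free_space (lists Z)" for c p
    unfolding L_map_def
  proof (rule lin_ext_cong)
    fix w assume "w \<in> keys p"
    with that have "w \<in> lists Z" by (auto simp: free_space_def)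
    then show "(case w of [] \<Rightarrow> 0 | x # v \<Rightarrow> vec_word (dia' c (basis x)) v) =
        (case w of [] \<Rightarrow> 0 | x # v \<Rightarrow> vec_word (dia c (basis x)) v)"
      using that by (cases w) (auto simp: dia'_def project_id free_space_closed)
  qed
  have "d = dia \<Longrightarrow> u \<in> lists Z \<Longrightarrow> v \<in> lists Z \<Longrightarrow>
    star_words dia' u v = star_words d u v \<and> star_words d u v \<in> free_space (lists Z)" for d
  proof (induction d u v rule: star_words.induct)
    case (3 d a u b v)
    have ab: "basis a \<in> free_space Z" "basis b \<in> free_space Z"
      using 3 by (auto simp: free_space_closed)
    then have "dia' (basis a) (basis b) = dia (basis a) (basis b)"
      by (simp add: dia'_def project_id)
    moreover have pre: "prepend x p \<in> free_space (lists Z)"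
      if "x \<in> Z" "p \<in> free_space (lists Z)" for x p
      unfolding prepend_def using that
      by (intro lin_ext_in_free_space[of _ "lists Z"]) (auto simp: free_space_closed)
    ultimately show ?case
      using 3 by (auto simp: L closed ab intro!: free_space_closed L_map_in_free_space)
  qed (auto simp: free_space_closed)
  with assms show ?thesis unfolding dia'_def by blast
qed

section \<open>The isomorphism with the polynomial algebra\<close>

definition mset_of_exponents :: "('i \<Rightarrow>\<^sub>0 nat) \<Rightarrow> 'i multiset" where
  "mset_of_exponents m = Abs_multiset (lookup m)"

lemma count_mset_of_exponents [simp]: "count (mset_of_exponents m) = lookup m"
  unfolding mset_of_exponents_def by (rule Abs_multiset_inverse) simp

lemma mset_of_exponents_simps [simp]:
  "mset_of_exponents 0 = {#}"
  "mset_of_exponents (m + n) = mset_of_exponents m + mset_of_exponents n"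
  "mset_of_exponents (Poly_Mapping.single i 1) = {#i#}"
  by (auto intro!: multiset_eqI simp: lookup_add lookup_single when_def)

lemma set_mset_of_exponents: "set_mset (mset_of_exponents m) = keys m"
  by (auto simp: in_keys_iff simp flip: count_greater_zero_iff)

text \<open>
  Exponent vectors are finitely supported multiplicity functions, so they encode the same data as multisets.
\<close>

lemma bij_mset_of_exponents:
  "bij_betw mset_of_exponents {m. keys m \<subseteq> I} {M. set_mset M \<subseteq> I}"
proof (rule bij_betwI')
  show "(mset_of_exponents m = mset_of_exponents n) = (m = n)" for m n :: "'a \<Rightarrow>\<^sub>0 nat"
    by (metis count_mset_of_exponents poly_mapping_eqI)
  show "mset_of_exponents m \<in> {M. set_mset M \<subseteq> I}" if "m \<in> {m. keys m \<subseteq> I}" for m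
    using that by (simp add: set_mset_of_exponents)
  show "\<exists>m\<in>{m. keys m \<subseteq> I}. M = mset_of_exponents m" if "M \<in> {M. set_mset M \<subseteq> I}" for M
  proof -
    have "finite {i. count M i \<noteq> 0}"
      by (rule finite_subset[of _ "set_mset M"]) (auto simp: not_in_iff)
    then have "lookup (Abs_poly_mapping (count M)) = count M"
      by (rule lookup_Abs_poly_mapping)
    then have "M = mset_of_exponents (Abs_poly_mapping (count M))"
      by (intro multiset_eqI) simp
    then show ?thesis
      using that set_mset_of_exponents by (metis mem_Collect_eq)
  qed
qed

lemma bij_lyndon_factorisation:
  "bij_betw concat_desc {M. set_mset M \<subseteq> {w \<in> lists Z. lyndon w}} (lists (Z :: 'z::linorder set))"
proof (rule bij_betwI')
  show "(concat_desc M = concat_desc N) = (M = N)"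
    if "M \<in> {M. set_mset M \<subseteq> {w \<in> lists Z. lyndon w}}" "N \<in> {M. set_mset M \<subseteq> {w \<in> lists Z. lyndon w}}" for M N
    using that lyndon_factorisation_unique[of M N] by auto
  show "concat_desc M \<in> lists Z" if "M \<in> {M. set_mset M \<subseteq> {w \<in> lists Z. lyndon w}}" for M
    using that by (force simp: concat_desc_def)
  show "\<exists>M\<in>{M. set_mset M \<subseteq> {w \<in> lists Z. lyndon w}}. w = concat_desc M" if "w \<in> lists Z" for w
    using lyndon_factorisation_exists[OF that] by auto
qed

lemma lin_times_left: "lin (\<lambda>P. P * (Q :: ('i::monoid_add \<Rightarrow>\<^sub>0 rat)))"
  by (rule linI) (simp_all add: scale_def mult_map_scale_conv_mult mult.assoc distrib_right)

context letter_algebra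
begin

text \<open>
  The value of a monomial under the substitution of basis vectors for variables.
\<close>

definition star_monomial :: "('z list \<Rightarrow>\<^sub>0 nat) \<Rightarrow> ('z list \<Rightarrow>\<^sub>0 rat)" where
  "star_monomial m = star.F (image_mset basis (mset_of_exponents m))"

lemma lin_ext_star_monomial_times:
  "lin_ext star_monomial (P * Q) = lin_ext star_monomial P \<star> lin_ext star_monomial Q"
proof (rule bilin_eqI[of "\<lambda>P Q. lin_ext star_monomial (P * Q)"])
  have l: "lin (\<lambda>P. lin_ext star_monomial (P * Q))" for Q
    by (rule lin_compose[OF lin_lin_ext lin_times_left])
  then show "lin (\<lambda>P. lin_ext star_monomial (P * Q))" for Q .
  show "lin (\<lambda>Q. lin_ext star_monomial (P * Q))" for P
    using l[of P] by (simp add: mult.commute)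
  show "lin (\<lambda>P. lin_ext star_monomial P \<star> lin_ext star_monomial Q)" for Q
    by (rule lin_compose[OF lin_star_left lin_lin_ext])
  show "lin (\<lambda>Q. lin_ext star_monomial P \<star> lin_ext star_monomial Q)" for P
    by (rule lin_compose[OF lin_star_right lin_lin_ext])
  fix m n :: "'z list \<Rightarrow>\<^sub>0 nat"
  have "basis m * basis n = basis (m + n)"
    by (simp add: basis_def mult_single)
  then show "lin_ext star_monomial (basis m * basis n) =
      lin_ext star_monomial (basis m) \<star> lin_ext star_monomial (basis n)"
    by (simp add: star_monomial_def)
qed

end

locale ordered_letter_algebra = letter_algebra dia
  for dia :: "('z::linorder \<Rightarrow>\<^sub>0 rat) \<Rightarrow> ('z \<Rightarrow>\<^sub>0 rat) \<Rightarrow> ('z \<Rightarrow>\<^sub>0 rat)"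
begin

text \<open>
  The factors are multiplied in increasing order, so that each new factor is the
  largest one.
\<close>

lemma star_product_leading_word:
  assumes "\<forall>l\<in>#M. lyndon l"
  shows "lookup (star.F (image_mset basis M)) (concat_desc M) > 0"
    and "\<And>w. w \<in> keys (star.F (image_mset basis M)) \<Longrightarrow> w \<noteq> concat_desc M \<Longrightarrow> w \<prec> concat_desc M"
proof -
  have "lookup (star.F (image_mset basis M)) (concat_desc M) > 0 \<and>
    (\<forall>w\<in>keys (star.F (image_mset basis M)). w \<noteq> concat_desc M \<longrightarrow> w \<prec> concat_desc M)"
    using assms
  proof (induction M rule: multiset_induct_max)
    case empty
    show ?case by (simp add: lookup_basis)
  next
    case (add l M)
    then have "lookup (star.F (image_mset basis M)) (concat_desc M) > 0"
      and "\<And>w. w \<in> keys (star.F (image_mset basis M)) \<Longrightarrow> w \<noteq> concat_desc M \<Longrightarrow> w \<prec> concat_desc M"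
      by auto
    with add show ?case
      using star_leading_word[of l M "star.F (image_mset basis M)"] by simp
  qed
  then show "lookup (star.F (image_mset basis M)) (concat_desc M) > 0"
    and "\<And>w. w \<in> keys (star.F (image_mset basis M)) \<Longrightarrow> w \<noteq> concat_desc M \<Longrightarrow> w \<prec> concat_desc M"
    by auto
qed

lemma star_product_in_free_space:
  assumes "\<And>u v. u \<in> W \<Longrightarrow> v \<in> W \<Longrightarrow> star_words dia u v \<in> free_space W"
    and "[] \<in> W" "set_mset M \<subseteq> W"
  shows "star.F (image_mset basis M) \<in> free_space W"
  using assms(3)
proof (induction M)
  case (add l M)
  then show ?case
    using assms(1) by (auto simp: star_basis_left intro!: lin_ext_in_free_space[of _ W])
qed (use assms(2) in \<open>simp add: free_space_closed\<close>)

end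

theorem corollary3p6:
  fixes Z :: "'z::linorder set"
    and dia :: "('z \<Rightarrow>\<^sub>0 rat) \<Rightarrow> ('z \<Rightarrow>\<^sub>0 rat) \<Rightarrow> ('z \<Rightarrow>\<^sub>0 rat)"
  assumes "countable Z"
    and "bilinear_on (free_space Z) dia"
    and "\<forall>p\<in>free_space Z. \<forall>q\<in>free_space Z. dia p q = dia q p"
    and "\<forall>p\<in>free_space Z. \<forall>q\<in>free_space Z. \<forall>r\<in>free_space Z.
           dia (dia p q) r = dia p (dia q r)"
  shows "free_polynomial_algebra (free_space (lists Z)) (star dia) (basis [])
           {w \<in> lists Z. lyndon w} basis"
proof -
  define dia' where "dia' = (\<lambda>p q. dia (project Z p) (project Z q))"
  interpret ordered_letter_algebra dia'
    unfolding dia'_def ordered_letter_algebra_def using assms(2-4) by (rule letter_algebra_project)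
  define I where "I = {w \<in> lists Z. lyndon w}"
  define \<Phi> where "\<Phi> = lin_ext star_monomial"
  have lin: "lin \<Phi>" unfolding \<Phi>_def by (rule lin_lin_ext)
  have ring: "poly_ring I = free_space {m :: 'z list \<Rightarrow>\<^sub>0 nat. keys m \<subseteq> I}"
    by (auto simp: poly_ring_def free_space_def)
  have words: "star_words dia' u v = star_words dia u v" "star_words dia' u v \<in> free_space (lists Z)"
    if "u \<in> lists Z" "v \<in> lists Z" for u v
    using star_words_project[of Z dia u v] assms(2) that by (auto simp: dia'_def bilinear_on_def)
  have bij: "bij_betw \<Phi> (poly_ring I) (free_space (lists Z))"
    unfolding ring \<Phi>_def
  proof (rule triangular_bij_betw[where rank = word_rank])
    show "bij_betw (\<lambda>m. concat_desc (mset_of_exponents m)) {m :: 'z list \<Rightarrow>\<^sub>0 nat. keys m \<subseteq> I} (lists Z)"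
      using bij_betw_trans[OF bij_mset_of_exponents bij_lyndon_factorisation] by (simp add: comp_def I_def)
    fix m :: "'z list \<Rightarrow>\<^sub>0 nat" assume "m \<in> {m. keys m \<subseteq> I}"
    then have m: "set_mset (mset_of_exponents m) \<subseteq> I"
      by (simp add: set_mset_of_exponents)
    then have "\<forall>l\<in>#mset_of_exponents m. lyndon l" by (auto simp: I_def)
    note leading = star_product_leading_word[OF this]
    from leading(1) show "lookup (star_monomial m) (concat_desc (mset_of_exponents m)) \<noteq> 0"
      by (simp add: star_monomial_def)
    show "word_rank w < word_rank (concat_desc (mset_of_exponents m))"
      if "w \<in> keys (star_monomial m)" "w \<noteq> concat_desc (mset_of_exponents m)" for w
      using leading(2) that by (auto simp: star_monomial_def intro: precedes_word_rank)
    have "star_monomial m \<in> free_space (lists Z)"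
      unfolding star_monomial_def using words m
      by (intro star_product_in_free_space) (auto simp: I_def)
    then show "keys (star_monomial m) \<subseteq> lists Z" by (simp add: free_space_def)
  qed
  have star_eq: "star dia' p q = star dia p q"
    if "p \<in> free_space (lists Z)" "q \<in> free_space (lists Z)" for p q
    unfolding star_def using that words
    unfolding free_space_def by (intro lin_ext_cong words(1)) blast+
  have "\<Phi> (P * Q) = star dia (\<Phi> P) (\<Phi> Q)" if "P \<in> poly_ring I" "Q \<in> poly_ring I" for P Q
  proof -
    have "\<Phi> P \<in> free_space (lists Z)" "\<Phi> Q \<in> free_space (lists Z)"
      using bij that by (auto simp: bij_betw_def)
    then show ?thesis
      using lin_ext_star_monomial_times[of P Q] by (simp add: \<Phi>_def star_eq)
  qed
  moreover have "\<Phi> 1 = basis []"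
  proof -
    have one: "1 = basis (0 :: 'z list \<Rightarrow>\<^sub>0 nat)" by (simp add: basis_def)
    show ?thesis unfolding one by (simp add: \<Phi>_def star_monomial_def)
  qed
  moreover have "\<Phi> (poly_var i) = basis i" for i
  proof -
    have "poly_var i = basis (Poly_Mapping.single i 1)" by (simp add: poly_var_def basis_def)
    then show ?thesis
      using mset_of_exponents_simps(3)[of i] by (simp add: \<Phi>_def star_monomial_def)
  qed
  ultimately show ?thesis
    using bij module_hom.add[OF lin] module_hom.scale[OF lin]
    unfolding free_polynomial_algebra_def I_def by (intro exI[of _ \<Phi>]) blast
qed

end
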